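(* Let $\mathcal{D}$ be an additive category with split idempotents and let $\mathcal{Z}$ be a (full) subcategory of $\mathcal{D}$. (1) If $\mathcal{D}$ is right triangulated, with suspension functor $\Sigma$, and has pseudokernels, then $\mathcal{Z}$ is coreflective and $\Sigma(\mathcal{Z})\subseteq\mathcal{Z}$ if and only if $\mathcal{Z}$ is precovering and closed under taking direct summands and cones. (2) If $\mathcal{D}$ is left triangulated, with loop functor $\Omega$, and has pseudocokernels, then $\mathcal{Z}$ is reflective and $\Omega(\mathcal{Z})\subseteq\mathcal{Z}$ if and only if $\mathcal{Z}$ is preenveloping and closed under taking direct summands and cocones.
   Context: All subcategories are full and closed under isomorphisms. A subcategory is coreflective (reflective) if its inclusion functor has a right (left) adjoint. A right triangulated category is an additive category $\mathcal{D}$ with an additive endofunctor $\Sigma:\mathcal{D}\to\mathcal{D}$ and a class $\nabla$ of sequences $X\to Y\to Z\to\Sigma X$, called right triangles, such that: (RT1) $\nabla$ is closed under isomorphisms of sequences, $0\to X\xrightarrow{1_X}X\to 0$ is a right triangle for every $X$, and every morphism $f:X\to Y$ embeds in a right triangle $X\xrightarrow{f}Y\to Z\to\Sigma X$; (RT2) if $X\xrightarrow{f}Y\xrightarrow{g}Z\xrightarrow{h}\Sigma X$ is a right triangle, so is $Y\xrightarrow{g}Z\xrightarrow{h}\Sigma X\xrightarrow{-\Sigma f}\Sigma Y$; (RT3) given right triangles $X\xrightarrow{f}Y\xrightarrow{g}Z\xrightarrow{h}\Sigma X$ and $X'\xrightarrow{f'}Y'\xrightarrow{g'}Z'\xrightarrow{h'}\Sigma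 X'$ and morphisms $a:X\to X'$, $b:Y\to Y'$ with $bf=f'a$, there is $c:Z\to Z'$ with $cg=g'b$ and $h'c=\Sigma(a)h$; (RT4) (octahedral axiom) given right triangles $X\xrightarrow{f}Y\xrightarrow{l}Z'\xrightarrow{h}\Sigma X$, $Y\xrightarrow{g}Z\xrightarrow{m}X'\xrightarrow{n}\Sigma Y$ and $X\xrightarrow{gf}Z\xrightarrow{p}Y'\xrightarrow{q}\Sigma X$, there are $u:Z'\to Y'$ and $v:Y'\to X'$ with $ul=pg$, $qu=h$, $vp=m$, $nv=\Sigma(f)q$, such that $Z'\xrightarrow{u}Y'\xrightarrow{v}X'\xrightarrow{\Sigma(l)n}\Sigma Z'$ is a right triangle. The functor $\Sigma$ need not be invertible. A left triangulated category $(\mathcal{D},\Omega,\Delta)$ is defined dually, with left triangles $\Omega Z\to X\to Y\to Z$. A cone of $f:X\to Y$ in a right triangulated category is an object $Z$ appearing in a right triangle $X\xrightarrow{f}Y\to Z\to\Sigma X$ (unique up to isomorphism); cocones in left triangulated categories are defined dually. $\mathcal{Z}$ is closed under cones (cocones) if the cone (cocone) of every morphism between objects of $\mathcal{Z}$ is in $\mathcal{Z}$. A pseudokernel of $f:A\to B$ is $k:K\to A$ with $fk=0$ through which every $k'$ with $fk'=0$ factors (not necessarily uniquely); pseudocokernels are dual. A $\mathcal{Z}$-precover of $A$ is $f:Z\to A$ with $Z\in\mathcal{Z}$ such that $\mathcal{D}(Z',f)$ is surjective for all $Z'\in\mathcal{Z}$; $\mathcal{Z}$ is precovering if every object has a $\mathcal{Z}$-precover.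 $\mathcal{Z}$-preenvelopes and preenveloping subcategories are defined dually. Split idempotents: each idempotent $e:A\to A$ factors as $e=ip$ with $pi=1$. *)

theory Defs
  imports "HOL-Algebra.Group"
begin

section \<open>Categories and functors\<close>

text \<open>The operations are unconstrained outside their intended domain: only composites of
  composable arrows, identities of objects and sums of parallel arrows are meaningful.
  Composition is written in the usual order, \<open>g \<cdot>\<^bsub>C\<^esub> f\<close> being first \<open>f\<close> and then \<open>g\<close>.\<close>

record ('o, 'm) cat =
  Ob :: "'o set"
  Ar :: "'m set"
  Dom :: "'m \<Rightarrow> 'o"
  Cod :: "'m \<Rightarrow> 'o"
  Ident :: "'o \<Rightarrow> 'm"
  Comp :: "'m \<Rightarrow> 'm \<Rightarrow> 'm"  (infixl \<open>\<cdot>\<index>\<close> 70)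

definition Hom :: "('o, 'm, 'x) cat_scheme \<Rightarrow> 'o \<Rightarrow> 'o \<Rightarrow> 'm set" where
  "Hom C A B = {f \<in> Ar C. Dom C f = A \<and> Cod C f = B}"

locale category =
  fixes C :: "('o, 'm, 'x) cat_scheme" (structure)
  assumes dom_ob: "f \<in> Ar C \<Longrightarrow> Dom C f \<in> Ob C"
    and cod_ob: "f \<in> Ar C \<Longrightarrow> Cod C f \<in> Ob C"
    and id_hom: "A \<in> Ob C \<Longrightarrow> Ident C A \<in> Hom C A A"
    and comp_hom: "\<lbrakk>f \<in> Hom C A B; g \<in> Hom C B D\<rbrakk> \<Longrightarrow> g \<cdot> f \<in> Hom C A D"
    and comp_assoc:
      "\<lbrakk>f \<in> Hom C A B; g \<in> Hom C B D; h \<in> Hom C D E\<rbrakk> \<Longrightarrow> h \<cdot> g \<cdot> f = h \<cdot> (g \<cdot> f)"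
    and id_left: "f \<in> Hom C A B \<Longrightarrow> Ident C B \<cdot> f = f"
    and id_right: "f \<in> Hom C A B \<Longrightarrow> f \<cdot> Ident C A = f"

definition is_iso :: "('o, 'm, 'x) cat_scheme \<Rightarrow> 'o \<Rightarrow> 'o \<Rightarrow> 'm \<Rightarrow> bool" where
  "is_iso C A B f \<longleftrightarrow> f \<in> Hom C A B \<and>
     (\<exists>g \<in> Hom C B A. g \<cdot>\<^bsub>C\<^esub> f = Ident C A \<and> f \<cdot>\<^bsub>C\<^esub> g = Ident C B)"

record ('o, 'm, 'p, 'n) funct =
  obmap :: "'o \<Rightarrow> 'p"
  armap :: "'m \<Rightarrow> 'n"

definition is_functor ::
  "('o, 'm, 'x) cat_scheme \<Rightarrow> ('p, 'n, 'y) cat_scheme \<Rightarrow> ('o, 'm, 'p, 'n) funct \<Rightarrow> bool" where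
  "is_functor C D F \<longleftrightarrow>
     (\<forall>A \<in> Ob C. obmap F A \<in> Ob D) \<and>
     (\<forall>A B. \<forall>f \<in> Hom C A B. armap F f \<in> Hom D (obmap F A) (obmap F B)) \<and>
     (\<forall>A \<in> Ob C. armap F (Ident C A) = Ident D (obmap F A)) \<and>
     (\<forall>A B E. \<forall>f \<in> Hom C A B. \<forall>g \<in> Hom C B E.
        armap F (g \<cdot>\<^bsub>C\<^esub> f) = armap F g \<cdot>\<^bsub>D\<^esub> armap F f)"

definition adjoint_functors ::
  "('o, 'm, 'x) cat_scheme \<Rightarrow> ('p, 'n, 'y) cat_scheme \<Rightarrow>
   ('o, 'm, 'p, 'n) funct \<Rightarrow> ('p, 'n, 'o, 'm) funct \<Rightarrow> bool" where
  \<comment> \<open>\<open>F : C \<rightarrow> D\<close> is left adjoint to \<open>G : D \<rightarrow> C\<close>\<close>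
  "adjoint_functors C D F G \<longleftrightarrow> is_functor C D F \<and> is_functor D C G \<and>
     (\<exists>\<phi>. (\<forall>A \<in> Ob C. \<forall>B \<in> Ob D.
             bij_betw (\<phi> A B) (Hom D (obmap F A) B) (Hom C A (obmap G B))) \<and>
          (\<forall>A \<in> Ob C. \<forall>A' \<in> Ob C. \<forall>B \<in> Ob D. \<forall>B' \<in> Ob D.
             \<forall>a \<in> Hom C A' A. \<forall>b \<in> Hom D B B'. \<forall>f \<in> Hom D (obmap F A) B.
               \<phi> A' B' (b \<cdot>\<^bsub>D\<^esub> f \<cdot>\<^bsub>D\<^esub> armap F a) = armap G b \<cdot>\<^bsub>C\<^esub> \<phi> A B f \<cdot>\<^bsub>C\<^esub> a))"


section \<open>Full subcategories\<close>

text \<open>A full subcategory is given by its set of objects.\<close>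

definition iso_closed_subcategory :: "('o, 'm, 'x) cat_scheme \<Rightarrow> 'o set \<Rightarrow> bool" where
  "iso_closed_subcategory C Z \<longleftrightarrow> Z \<subseteq> Ob C \<and> (\<forall>A B f. A \<in> Z \<and> is_iso C A B f \<longrightarrow> B \<in> Z)"

definition full_subcat :: "('o, 'm, 'x) cat_scheme \<Rightarrow> 'o set \<Rightarrow> ('o, 'm, 'x) cat_scheme" where
  "full_subcat C Z = C\<lparr>Ob := Z, Ar := {f \<in> Ar C. Dom C f \<in> Z \<and> Cod C f \<in> Z}\<rparr>"

definition inclusion :: "('o, 'm, 'o, 'm) funct" where
  "inclusion = \<lparr>obmap = (\<lambda>A. A), armap = (\<lambda>f. f)\<rparr>"

definition coreflective :: "('o, 'm, 'x) cat_scheme \<Rightarrow> 'o set \<Rightarrow> bool" where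
  "coreflective C Z \<longleftrightarrow> (\<exists>G. adjoint_functors (full_subcat C Z) C inclusion G)"

definition reflective :: "('o, 'm, 'x) cat_scheme \<Rightarrow> 'o set \<Rightarrow> bool" where
  "reflective C Z \<longleftrightarrow> (\<exists>G. adjoint_functors C (full_subcat C Z) G inclusion)"

definition is_precover :: "('o, 'm, 'x) cat_scheme \<Rightarrow> 'o set \<Rightarrow> 'o \<Rightarrow> 'm \<Rightarrow> bool" where
  "is_precover C Z A f \<longleftrightarrow> f \<in> Ar C \<and> Dom C f \<in> Z \<and> Cod C f = A \<and>
     (\<forall>Z' \<in> Z. (\<lambda>h. f \<cdot>\<^bsub>C\<^esub> h) ` Hom C Z' (Dom C f) = Hom C Z' A)"

definition precovering :: "('o, 'm, 'x) cat_scheme \<Rightarrow> 'o set \<Rightarrow> bool" where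
  "precovering C Z \<longleftrightarrow> (\<forall>A \<in> Ob C. \<exists>f. is_precover C Z A f)"

definition is_preenvelope :: "('o, 'm, 'x) cat_scheme \<Rightarrow> 'o set \<Rightarrow> 'o \<Rightarrow> 'm \<Rightarrow> bool" where
  "is_preenvelope C Z A f \<longleftrightarrow> f \<in> Ar C \<and> Dom C f = A \<and> Cod C f \<in> Z \<and>
     (\<forall>Z' \<in> Z. (\<lambda>h. h \<cdot>\<^bsub>C\<^esub> f) ` Hom C (Cod C f) Z' = Hom C A Z')"

definition preenveloping :: "('o, 'm, 'x) cat_scheme \<Rightarrow> 'o set \<Rightarrow> bool" where
  "preenveloping C Z \<longleftrightarrow> (\<forall>A \<in> Ob C. \<exists>f. is_preenvelope C Z A f)"

definition split_idempotents :: "('o, 'm, 'x) cat_scheme \<Rightarrow> bool" where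
  "split_idempotents C \<longleftrightarrow>
     (\<forall>A \<in> Ob C. \<forall>e \<in> Hom C A A. e \<cdot>\<^bsub>C\<^esub> e = e \<longrightarrow>
        (\<exists>B \<in> Ob C. \<exists>i \<in> Hom C B A. \<exists>p \<in> Hom C A B. e = i \<cdot>\<^bsub>C\<^esub> p \<and> p \<cdot>\<^bsub>C\<^esub> i = Ident C B))"


section \<open>Additive categories\<close>

record ('o, 'm) preadd_cat = "('o, 'm) cat" +
  Add :: "'m \<Rightarrow> 'm \<Rightarrow> 'm"  (infixl \<open>\<boxplus>\<index>\<close> 65)
  Zero :: "'o \<Rightarrow> 'o \<Rightarrow> 'm"

definition hom_group :: "('o, 'm, 'x) preadd_cat_scheme \<Rightarrow> 'o \<Rightarrow> 'o \<Rightarrow> 'm monoid" where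
  "hom_group C A B = \<lparr>carrier = Hom C A B, mult = Add C, one = Zero C A B\<rparr>"

definition neg :: "('o, 'm, 'x) preadd_cat_scheme \<Rightarrow> 'm \<Rightarrow> 'm" where
  "neg C f = m_inv (hom_group C (Dom C f) (Cod C f)) f"

locale preadditive_category = category C
  for C :: "('o, 'm, 'x) preadd_cat_scheme" (structure) +
  assumes hom_comm_group: "\<lbrakk>A \<in> Ob C; B \<in> Ob C\<rbrakk> \<Longrightarrow> comm_group (hom_group C A B)"
    and comp_add_left:
      "\<lbrakk>f \<in> Hom C A B; g \<in> Hom C B D; g' \<in> Hom C B D\<rbrakk> \<Longrightarrow> (g \<boxplus> g') \<cdot> f = g \<cdot> f \<boxplus> g' \<cdot> f"
    and comp_add_right:
      "\<lbrakk>f \<in> Hom C A B; f' \<in> Hom C A B; g \<in> Hom C B D\<rbrakk> \<Longrightarrow> g \<cdot> (f \<boxplus> f') = g \<cdot> f \<boxplus> g \<cdot> f'"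

definition zero_object :: "('o, 'm, 'x) cat_scheme \<Rightarrow> 'o \<Rightarrow> bool" where
  "zero_object C N \<longleftrightarrow> N \<in> Ob C \<and>
     (\<forall>A \<in> Ob C. (\<exists>!f. f \<in> Hom C N A) \<and> (\<exists>!f. f \<in> Hom C A N))"

definition is_biproduct ::
  "('o, 'm, 'x) preadd_cat_scheme \<Rightarrow> 'o \<Rightarrow> 'o \<Rightarrow> 'o \<Rightarrow> 'm \<Rightarrow> 'm \<Rightarrow> 'm \<Rightarrow> 'm \<Rightarrow> bool" where
  "is_biproduct C A B X i j p q \<longleftrightarrow> A \<in> Ob C \<and> B \<in> Ob C \<and> X \<in> Ob C \<and>
     i \<in> Hom C A X \<and> j \<in> Hom C B X \<and> p \<in> Hom C X A \<and> q \<in> Hom C X B \<and>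
     p \<cdot>\<^bsub>C\<^esub> i = Ident C A \<and> q \<cdot>\<^bsub>C\<^esub> j = Ident C B \<and>
     q \<cdot>\<^bsub>C\<^esub> i = Zero C A B \<and> p \<cdot>\<^bsub>C\<^esub> j = Zero C B A \<and>
     i \<cdot>\<^bsub>C\<^esub> p \<boxplus>\<^bsub>C\<^esub> j \<cdot>\<^bsub>C\<^esub> q = Ident C X"

locale additive_category = preadditive_category C
  for C :: "('o, 'm, 'x) preadd_cat_scheme" (structure) +
  assumes ex_zero_object: "\<exists>N. zero_object C N"
    and ex_biproduct: "\<lbrakk>A \<in> Ob C; B \<in> Ob C\<rbrakk> \<Longrightarrow> \<exists>X i j p q. is_biproduct C A B X i j p q"

definition additive_functor ::
  "('o, 'm, 'x) preadd_cat_scheme \<Rightarrow> ('p, 'n, 'y) preadd_cat_scheme \<Rightarrow>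
   ('o, 'm, 'p, 'n) funct \<Rightarrow> bool" where
  "additive_functor C D F \<longleftrightarrow> is_functor C D F \<and>
     (\<forall>A B. \<forall>f \<in> Hom C A B. \<forall>g \<in> Hom C A B.
        armap F (f \<boxplus>\<^bsub>C\<^esub> g) = armap F f \<boxplus>\<^bsub>D\<^esub> armap F g)"

definition closed_under_summands :: "('o, 'm, 'x) preadd_cat_scheme \<Rightarrow> 'o set \<Rightarrow> bool" where
  "closed_under_summands C Z \<longleftrightarrow>
     (\<forall>A B X i j p q. X \<in> Z \<and> is_biproduct C A B X i j p q \<longrightarrow> A \<in> Z)"

definition is_pseudokernel :: "('o, 'm, 'x) preadd_cat_scheme \<Rightarrow> 'm \<Rightarrow> 'm \<Rightarrow> bool" where
  "is_pseudokernel C f k \<longleftrightarrow> f \<in> Ar C \<and> k \<in> Ar C \<and> Cod C k = Dom C f \<and>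
     f \<cdot>\<^bsub>C\<^esub> k = Zero C (Dom C k) (Cod C f) \<and>
     (\<forall>K' \<in> Ob C. \<forall>k' \<in> Hom C K' (Dom C f). f \<cdot>\<^bsub>C\<^esub> k' = Zero C K' (Cod C f) \<longrightarrow>
        (\<exists>u \<in> Hom C K' (Dom C k). k \<cdot>\<^bsub>C\<^esub> u = k'))"

definition is_pseudocokernel :: "('o, 'm, 'x) preadd_cat_scheme \<Rightarrow> 'm \<Rightarrow> 'm \<Rightarrow> bool" where
  "is_pseudocokernel C f k \<longleftrightarrow> f \<in> Ar C \<and> k \<in> Ar C \<and> Dom C k = Cod C f \<and>
     k \<cdot>\<^bsub>C\<^esub> f = Zero C (Dom C f) (Cod C k) \<and>
     (\<forall>K' \<in> Ob C. \<forall>k' \<in> Hom C (Cod C f) K'. k' \<cdot>\<^bsub>C\<^esub> f = Zero C (Dom C f) K' \<longrightarrow>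
        (\<exists>u \<in> Hom C (Cod C k) K'. u \<cdot>\<^bsub>C\<^esub> k = k'))"

definition has_pseudokernels :: "('o, 'm, 'x) preadd_cat_scheme \<Rightarrow> bool" where
  "has_pseudokernels C \<longleftrightarrow> (\<forall>f \<in> Ar C. \<exists>k. is_pseudokernel C f k)"

definition has_pseudocokernels :: "('o, 'm, 'x) preadd_cat_scheme \<Rightarrow> bool" where
  "has_pseudocokernels C \<longleftrightarrow> (\<forall>f \<in> Ar C. \<exists>k. is_pseudocokernel C f k)"


section \<open>Right and left triangulated categories\<close>

text \<open>A sequence \<open>X \<rightarrow> Y \<rightarrow> Z \<rightarrow> \<Sigma> X\<close> is encoded as the triple of its arrows, which determine
  the objects.\<close>

definition right_sequence ::
  "('o, 'm, 'x) cat_scheme \<Rightarrow> ('o, 'm, 'o, 'm) funct \<Rightarrow> 'm \<times> 'm \<times> 'm \<Rightarrow> bool" where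
  "right_sequence C S = (\<lambda>(f, g, h). f \<in> Ar C \<and> g \<in> Ar C \<and> h \<in> Ar C \<and>
     Cod C f = Dom C g \<and> Cod C g = Dom C h \<and> Cod C h = obmap S (Dom C f))"

definition right_sequence_iso ::
  "('o, 'm, 'x) cat_scheme \<Rightarrow> ('o, 'm, 'o, 'm) funct \<Rightarrow> 'm \<times> 'm \<times> 'm \<Rightarrow> 'm \<times> 'm \<times> 'm \<Rightarrow> bool"
  where
  "right_sequence_iso C S = (\<lambda>(f, g, h) (f', g', h').
     \<exists>a b c. is_iso C (Dom C f) (Dom C f') a \<and> is_iso C (Dom C g) (Dom C g') b \<and>
       is_iso C (Dom C h) (Dom C h') c \<and>
       b \<cdot>\<^bsub>C\<^esub> f = f' \<cdot>\<^bsub>C\<^esub> a \<and> c \<cdot>\<^bsub>C\<^esub> g = g' \<cdot>\<^bsub>C\<^esub> b \<and> armap S a \<cdot>\<^bsub>C\<^esub> h = h' \<cdot>\<^bsub>C\<^esub> c)"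

text \<open>In \<open>RT1_zero\<close> the last object of the sequence \<open>0 \<rightarrow> X \<rightarrow> X \<rightarrow> 0\<close> is \<open>\<Sigma> 0\<close>, a zero object
  because \<open>\<Sigma>\<close> is additive.\<close>

locale right_triangulated_category = additive_category C
  for C :: "('o, 'm, 'x) preadd_cat_scheme" (structure) +
  fixes S :: "('o, 'm, 'o, 'm) funct"
    and T :: "('m \<times> 'm \<times> 'm) set"
  assumes suspension_additive: "additive_functor C C S"
    and triangle_sequence: "t \<in> T \<Longrightarrow> right_sequence C S t"
    and RT1_iso: "\<lbrakk>t \<in> T; right_sequence C S t'; right_sequence_iso C S t t'\<rbrakk> \<Longrightarrow> t' \<in> T"
    and RT1_zero: "\<lbrakk>zero_object C N; X \<in> Ob C\<rbrakk> \<Longrightarrow> (Zero C N X, Ident C X, Zero C X (obmap S N)) \<in> T"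
    and RT1_embed: "f \<in> Ar C \<Longrightarrow> \<exists>g h. (f, g, h) \<in> T"
    and RT2: "(f, g, h) \<in> T \<Longrightarrow> (g, h, neg C (armap S f)) \<in> T"
    and RT3: "\<lbrakk>(f, g, h) \<in> T; (f', g', h') \<in> T;
        a \<in> Hom C (Dom C f) (Dom C f'); b \<in> Hom C (Cod C f) (Cod C f'); b \<cdot> f = f' \<cdot> a\<rbrakk>
      \<Longrightarrow> \<exists>c \<in> Hom C (Cod C g) (Cod C g'). c \<cdot> g = g' \<cdot> b \<and> h' \<cdot> c = armap S a \<cdot> h"
    and RT4: "\<lbrakk>Cod C f = Dom C g; (f, l, h) \<in> T; (g, m, n) \<in> T; (g \<cdot> f, p, q) \<in> T\<rbrakk>
      \<Longrightarrow> \<exists>u \<in> Hom C (Cod C l) (Cod C p). \<exists>v \<in> Hom C (Cod C p) (Cod C m).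
            u \<cdot> l = p \<cdot> g \<and> q \<cdot> u = h \<and> v \<cdot> p = m \<and> n \<cdot> v = armap S f \<cdot> q \<and>
            (u, v, armap S l \<cdot> n) \<in> T"

definition opposite :: "('o, 'm, 'x) preadd_cat_scheme \<Rightarrow> ('o, 'm, 'x) preadd_cat_scheme" where
  "opposite C = C\<lparr>Dom := Cod C, Cod := Dom C, Comp := (\<lambda>g f. f \<cdot>\<^bsub>C\<^esub> g),
     Zero := (\<lambda>A B. Zero C B A)\<rparr>"

text \<open>The triple \<open>(h, f, g)\<close> encodes a left triangle \<open>\<Omega> Z \<rightarrow> X \<rightarrow> Y \<rightarrow> Z\<close> with arrows in this order;
  in the opposite category it reads \<open>Z \<rightarrow> Y \<rightarrow> X \<rightarrow> \<Omega> Z\<close>, with arrows \<open>g\<close>, \<open>f\<close>, \<open>h\<close>.\<close>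

definition left_triangulated_category ::
  "('o, 'm, 'x) preadd_cat_scheme \<Rightarrow> ('o, 'm, 'o, 'm) funct \<Rightarrow> ('m \<times> 'm \<times> 'm) set \<Rightarrow> bool" where
  "left_triangulated_category C W T \<longleftrightarrow>
     right_triangulated_category (opposite C) W {(g, f, h). (h, f, g) \<in> T}"

definition closed_under_cones ::
  "('o, 'm, 'x) cat_scheme \<Rightarrow> ('m \<times> 'm \<times> 'm) set \<Rightarrow> 'o set \<Rightarrow> bool" where
  "closed_under_cones C T Z \<longleftrightarrow>
     (\<forall>(f, g, h) \<in> T. Dom C f \<in> Z \<and> Cod C f \<in> Z \<longrightarrow> Cod C g \<in> Z)"

definition closed_under_cocones ::
  "('o, 'm, 'x) cat_scheme \<Rightarrow> ('m \<times> 'm \<times> 'm) set \<Rightarrow> 'o set \<Rightarrow> bool" where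
  \<comment> \<open>the cocone of \<open>g\<close> in the left triangle \<open>(h, f, g)\<close> is the domain of \<open>f\<close>\<close>
  "closed_under_cocones C T Z \<longleftrightarrow>
     (\<forall>(h, f, g) \<in> T. Dom C g \<in> Z \<and> Cod C g \<in> Z \<longrightarrow> Dom C f \<in> Z)"

end

theory Submission
  imports Defs
begin

section \<open>Coreflections\<close>

text \<open>Coreflectivity means that every object \<open>A\<close> has a universal arrow from
  \<open>Z\<close>, the counit at \<open>A\<close> (\<open>is_coreflection\<close>): composing with
  it is bijective on maps out of objects of \<open>Z\<close>, where a precover asks only for
  surjectivity. Both directions of (1) turn on this gap.

  If coreflections exist, an object lies in \<open>Z\<close> as soon as its coreflection has a
  section (\<open>coreflection_section_imp_mem\<close>). For a summand of an object of
  \<open>Z\<close> the section comes from lifting the projection. For the cone of a map X -> Y in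
  \<open>Z\<close> it is a sum of two terms, one built from a lift over Y and one from a lift over
  \<Sigma>X (\<open>coreflective_closed_under_cones\<close>).

  Conversely, \<Sigma>X is the cone of the map from X to a zero object. To improve a precover f : Y
  -> A to a coreflection, the maps from \<open>Z\<close> killed by f have to be divided out. They
  all factor through a single map X -> Y in \<open>Z\<close>, obtained by precovering the domain of
  a pseudokernel of f. Its cone g : Y -> D stays in \<open>Z\<close>, f descends to f' : D -> A, and
  f' lifts back to r : D -> Y. Then g r is idempotent, and f' restricted to its image is the
  coreflection (\<open>precovering_imp_coreflective\<close>). The image stays in \<open>Z\<close>
  because idempotents split, so that a retract has a complement (\<open>retract_mem\<close>).

  Part (2) is (1) in the opposite category; the main point there is that adjunctions reverse
  (\<open>adjoint_functors_opposite\<close>).\<close>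

definition is_coreflection :: "('o, 'm, 'x) cat_scheme \<Rightarrow> 'o set \<Rightarrow> 'o \<Rightarrow> 'm \<Rightarrow> bool" where
  "is_coreflection C Z A e \<longleftrightarrow> e \<in> Ar C \<and> Dom C e \<in> Z \<and> Cod C e = A \<and>
     (\<forall>Z' \<in> Z. bij_betw (\<lambda>h. e \<cdot>\<^bsub>C\<^esub> h) (Hom C Z' (Dom C e)) (Hom C Z' A))"

lemma Hom_full_subcat: "A \<in> Z \<Longrightarrow> B \<in> Z \<Longrightarrow> Hom (full_subcat C Z) A B = Hom C A B"
  by (auto simp: Hom_def full_subcat_def)

lemma Hom_full_subcatD:
  "f \<in> Hom (full_subcat C Z) A B \<Longrightarrow> f \<in> Hom C A B \<and> A \<in> Z \<and> B \<in> Z"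
  by (auto simp: Hom_def full_subcat_def)

lemma full_subcat_simps [simp]:
  "Ob (full_subcat C Z) = Z" "Ar (full_subcat C Z) = {f \<in> Ar C. Dom C f \<in> Z \<and> Cod C f \<in> Z}"
  "Dom (full_subcat C Z) = Dom C" "Cod (full_subcat C Z) = Cod C" "Comp (full_subcat C Z) = Comp C"
  "Ident (full_subcat C Z) = Ident C"
  by (auto simp: full_subcat_def)

lemma inclusion_simps [simp]: "obmap inclusion A = A" "armap inclusion f = f"
  by (auto simp: inclusion_def)

lemma adjoint_functorsE:
  assumes "adjoint_functors C D F G"
  obtains \<phi> where "is_functor C D F" "is_functor D C G"
    "\<And>A B. A \<in> Ob C \<Longrightarrow> B \<in> Ob D \<Longrightarrow>
        bij_betw (\<phi> A B) (Hom D (obmap F A) B) (Hom C A (obmap G B))"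
    "\<And>A A' B B' a b f. \<lbrakk>A \<in> Ob C; A' \<in> Ob C; B \<in> Ob D; B' \<in> Ob D; a \<in> Hom C A' A;
        b \<in> Hom D B B'; f \<in> Hom D (obmap F A) B\<rbrakk>
        \<Longrightarrow> \<phi> A' B' (b \<cdot>\<^bsub>D\<^esub> f \<cdot>\<^bsub>D\<^esub> armap F a) = armap G b \<cdot>\<^bsub>C\<^esub> \<phi> A B f \<cdot>\<^bsub>C\<^esub> a"
  using assms unfolding adjoint_functors_def by (elim conjE exE) (rule that, blast+)

context category
begin

section \<open>Precovers, coreflections and the adjunction they encode\<close>

lemma Hom_Ob: "f \<in> Hom C A B \<Longrightarrow> A \<in> Ob C \<and> B \<in> Ob C"
  using dom_ob cod_ob by (auto simp: Hom_def)

lemma is_coreflection_precover: "is_coreflection C Z A e \<Longrightarrow> is_precover C Z A e"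
  unfolding is_coreflection_def is_precover_def bij_betw_def by blast

lemma is_precover_lift:
  assumes e: "is_precover C Z A e" and W: "W \<in> Z" and k: "k \<in> Hom C W A"
  shows "\<exists>m \<in> Hom C W (Dom C e). e \<cdot> m = k"
proof -
  have "k \<in> (\<lambda>h. e \<cdot> h) ` Hom C W (Dom C e)" using assms by (simp add: is_precover_def)
  then show ?thesis by auto
qed

text \<open>Both \<open>s \<cdot> e\<close> and the identity become \<open>e\<close> after
  composition with \<open>e\<close>, so they agree by injectivity, and \<open>e\<close> is an
  isomorphism out of an object of \<open>Z\<close>.\<close>

lemma coreflection_section_imp_mem:
  assumes Z: "iso_closed_subcategory C Z" and e: "is_coreflection C Z A e"
    and s: "s \<in> Hom C A (Dom C e)" "e \<cdot> s = Ident C A"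
  shows "A \<in> Z"
proof -
  let ?B = "Dom C e"
  have eh: "e \<in> Hom C ?B A" and B: "?B \<in> Z" using e by (auto simp: is_coreflection_def Hom_def)
  have inj: "inj_on (\<lambda>h. e \<cdot> h) (Hom C ?B ?B)"
    using e B by (auto simp: is_coreflection_def bij_betw_def)
  have seh: "s \<cdot> e \<in> Hom C ?B ?B" using comp_hom[OF eh s(1)] .
  have idh: "Ident C ?B \<in> Hom C ?B ?B" using id_hom Hom_Ob[OF eh] by blast
  have "e \<cdot> (s \<cdot> e) = e \<cdot> Ident C ?B"
    using comp_assoc[OF eh s(1) eh] s(2) id_left[OF eh] id_right[OF eh] by simp
  then have "s \<cdot> e = Ident C ?B" using inj seh idh by (auto dest: inj_onD)
  then have "is_iso C ?B A e" using eh s by (auto simp: is_iso_def)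
  then show ?thesis using Z B by (auto simp: iso_closed_subcategory_def)
qed

text \<open>Yoneda: the arrow is the counit, the map that \<open>\<phi>\<close> sends to the
  identity of \<open>obmap G A\<close>. Naturality in the first argument makes
  \<open>\<phi> X A\<close> a left inverse of composition with it.\<close>

lemma coreflective_ex_coreflection:
  assumes Z: "Z \<subseteq> Ob C" and c: "coreflective C Z" and A: "A \<in> Ob C"
  shows "\<exists>e. is_coreflection C Z A e"
proof -
  let ?D = "full_subcat C Z"
  obtain G where adj: "adjoint_functors ?D C inclusion G"
    using c by (auto simp: coreflective_def)
  obtain \<phi> where G: "is_functor C ?D G"
    and bij: "\<And>A B. A \<in> Z \<Longrightarrow> B \<in> Ob C \<Longrightarrow>
        bij_betw (\<phi> A B) (Hom C A B) (Hom ?D A (obmap G B))"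
    and nat: "\<And>A A' B B' a b f. \<lbrakk>A \<in> Z; A' \<in> Z; B \<in> Ob C; B' \<in> Ob C; a \<in> Hom ?D A' A;
        b \<in> Hom C B B'; f \<in> Hom C A B\<rbrakk>
        \<Longrightarrow> \<phi> A' B' (b \<cdot> f \<cdot> a) = armap G b \<cdot> \<phi> A B f \<cdot> a"
    using adjoint_functorsE[OF adj, unfolded full_subcat_simps inclusion_simps] by metis
  let ?B = "obmap G A"
  have B: "?B \<in> Z" using G A by (auto simp: is_functor_def)
  have BO: "?B \<in> Ob C" using B Z by auto
  have idB: "Ident C ?B \<in> Hom C ?B ?B" using id_hom BO by blast
  have "Ident C ?B \<in> \<phi> ?B A ` Hom C ?B A"
    using bij[OF B A] idB Hom_full_subcat[OF B B, of C] by (auto simp: bij_betw_def)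
  then obtain e where e: "e \<in> Hom C ?B A" and \<phi>e: "\<phi> ?B A e = Ident C ?B" by auto
  have GI: "armap G (Ident C A) = Ident C ?B" using G A by (auto simp: is_functor_def)
  have \<phi>em: "\<phi> X A (e \<cdot> m) = m" if "X \<in> Z" "m \<in> Hom C X ?B" for X m
  proof -
    have "\<phi> X A (Ident C A \<cdot> e \<cdot> m) = armap G (Ident C A) \<cdot> \<phi> ?B A e \<cdot> m"
      using nat[OF B that(1) A A _ id_hom[OF A] e] that B by (auto simp: Hom_full_subcat)
    then show ?thesis using GI \<phi>e id_left[OF e] id_left[OF idB] id_left[OF that(2)] by simp
  qed
  have "bij_betw (\<lambda>h. e \<cdot> h) (Hom C X ?B) (Hom C X A)" if X: "X \<in> Z" for X
  proof (rule bij_betw_imageI)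
    show "inj_on (\<lambda>h. e \<cdot> h) (Hom C X ?B)" using \<phi>em[OF X] by (metis inj_onI)
    have "k \<in> (\<lambda>h. e \<cdot> h) ` Hom C X ?B" if k: "k \<in> Hom C X A" for k
    proof -
      have p: "\<phi> X A k \<in> Hom C X ?B"
        using bij[OF X A] k Hom_full_subcat[OF X B, of C] by (auto simp: bij_betw_def)
      have "\<phi> X A (e \<cdot> \<phi> X A k) = \<phi> X A k" using \<phi>em[OF X p] .
      then have "e \<cdot> \<phi> X A k = k"
        using bij[OF X A] k comp_hom[OF p e] by (auto simp: bij_betw_def dest: inj_onD)
      then show ?thesis using p by force
    qed
    then show "(\<lambda>h. e \<cdot> h) ` Hom C X ?B = Hom C X A" using comp_hom[OF _ e] by auto
  qed
  then show ?thesis using e B unfolding is_coreflection_def Hom_def by auto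
qed

text \<open>Chosen universal arrows determine the right adjoint: its action on arrows and the
  adjunction bijection are both given by unique lifting. All equations between lifts are checked
  after composing with \<open>\<epsilon>\<close>.\<close>

lemma coreflective_if_ex_coreflection:
  assumes Z: "Z \<subseteq> Ob C" and ex: "\<And>A. A \<in> Ob C \<Longrightarrow> \<exists>e. is_coreflection C Z A e"
  shows "coreflective C Z"
proof -
  let ?D = "full_subcat C Z"
  obtain \<epsilon> where \<epsilon>: "\<And>A. A \<in> Ob C \<Longrightarrow> is_coreflection C Z A (\<epsilon> A)" using ex by metis
  define g where "g A = Dom C (\<epsilon> A)" for A
  have gZ: "g A \<in> Z" and \<epsilon>h: "\<epsilon> A \<in> Hom C (g A) A" if "A \<in> Ob C" for A
    using \<epsilon>[OF that] by (auto simp: is_coreflection_def g_def Hom_def)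
  have bij: "bij_betw (\<lambda>h. \<epsilon> A \<cdot> h) (Hom C X (g A)) (Hom C X A)"
    if "A \<in> Ob C" "X \<in> Z" for A X
    using \<epsilon>[OF that(1)] that(2) by (auto simp: is_coreflection_def g_def)
  define lift where "lift X A k = the_inv_into (Hom C X (g A)) (\<lambda>h. \<epsilon> A \<cdot> h) k" for X A k
  have lift_hom: "lift X A k \<in> Hom C X (g A)" and lift_comp: "\<epsilon> A \<cdot> lift X A k = k"
    if "X \<in> Z" "k \<in> Hom C X A" for X A k
  proof -
    have A: "A \<in> Ob C" using that Hom_Ob by blast
    show "lift X A k \<in> Hom C X (g A)"
      using bij_betw_the_inv_into[OF bij[OF A that(1)]] that(2) unfolding lift_def bij_betw_def
      by blast
    show "\<epsilon> A \<cdot> lift X A k = k"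
      using f_the_inv_into_f_bij_betw[OF bij[OF A that(1)]] that(2) unfolding lift_def by auto
  qed
  have uniq: "m = n"
    if "X \<in> Z" "A \<in> Ob C" "m \<in> Hom C X (g A)" "n \<in> Hom C X (g A)" "\<epsilon> A \<cdot> m = \<epsilon> A \<cdot> n" for X A m n
    using bij[OF that(2,1)] that(3-5) by (auto simp: bij_betw_def dest: inj_onD)
  \<comment> \<open>The only choice that makes \<open>\<epsilon>\<close> natural.\<close>
  define ga where "ga f = lift (g (Dom C f)) (Cod C f) (f \<cdot> \<epsilon> (Dom C f))" for f
  have ga_hom: "ga f \<in> Hom C (g A) (g B)" and ga_comp: "\<epsilon> B \<cdot> ga f = f \<cdot> \<epsilon> A"
    if f: "f \<in> Hom C A B" for f A B
  proof -
    have A: "A \<in> Ob C" and d: "Dom C f = A" "Cod C f = B"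
      using f Hom_Ob[OF f] by (auto simp: Hom_def)
    show "ga f \<in> Hom C (g A) (g B)" "\<epsilon> B \<cdot> ga f = f \<cdot> \<epsilon> A"
      unfolding ga_def d
      using lift_hom[OF gZ[OF A] comp_hom[OF \<epsilon>h[OF A] f]]
        lift_comp[OF gZ[OF A] comp_hom[OF \<epsilon>h[OF A] f]] by auto
  qed
  define G where "G = \<lparr>obmap = g, armap = ga\<rparr>"
  have G_simps [simp]: "obmap G = g" "armap G = ga" by (auto simp: G_def)
  have ga_id: "ga (Ident C A) = Ident C (g A)" if A: "A \<in> Ob C" for A
  proof -
    have gO: "g A \<in> Ob C" using gZ[OF A] Z by auto
    show ?thesis
      using uniq[OF gZ[OF A] A ga_hom[OF id_hom[OF A]] id_hom[OF gO]]
        ga_comp[OF id_hom[OF A]] id_left[OF \<epsilon>h[OF A]] id_right[OF \<epsilon>h[OF A]] by simp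
  qed
  have ga_comp2: "ga (k \<cdot> f) = ga k \<cdot> ga f" if f: "f \<in> Hom C A B" and k: "k \<in> Hom C B E" for f k A B E
  proof -
    have O: "A \<in> Ob C" "B \<in> Ob C" "E \<in> Ob C" using Hom_Ob f k by blast+
    have "\<epsilon> E \<cdot> (ga k \<cdot> ga f) = \<epsilon> E \<cdot> ga k \<cdot> ga f"
      using comp_assoc[OF ga_hom[OF f] ga_hom[OF k] \<epsilon>h[OF O(3)]] by simp
    also have "\<dots> = k \<cdot> (\<epsilon> B \<cdot> ga f)"
      using comp_assoc[OF ga_hom[OF f] \<epsilon>h[OF O(2)] k] ga_comp[OF k] by simp
    also have "\<dots> = k \<cdot> f \<cdot> \<epsilon> A" using comp_assoc[OF \<epsilon>h[OF O(1)] f k] ga_comp[OF f] by simp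
    finally show ?thesis
      using uniq[OF gZ[OF O(1)] O(3) ga_hom[OF comp_hom[OF f k]]
          comp_hom[OF ga_hom[OF f] ga_hom[OF k]]] ga_comp[OF comp_hom[OF f k]] by simp
  qed
  have F1: "is_functor ?D C inclusion"
    using Z by (auto simp: is_functor_def dest: Hom_full_subcatD)
  have F2: "is_functor C ?D G"
    unfolding is_functor_def
  proof (intro conjI ballI allI)
    fix A B f assume f: "f \<in> Hom C A B"
    then have "A \<in> Ob C" "B \<in> Ob C" using Hom_Ob by blast+
    then show "armap G f \<in> Hom ?D (obmap G A) (obmap G B)"
      using ga_hom[OF f] gZ by (simp add: Hom_full_subcat)
  qed (use gZ ga_id ga_comp2 in auto)
  have "bij_betw (lift A B) (Hom C A B) (Hom ?D A (g B))" if "A \<in> Z" "B \<in> Ob C" for A B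
    using bij_betw_the_inv_into[OF bij[OF that(2,1)]] Hom_full_subcat[OF that(1) gZ[OF that(2)], of C]
    unfolding lift_def[abs_def] by simp
  moreover have "lift A' B' (b \<cdot> f \<cdot> a) = ga b \<cdot> lift A B f \<cdot> a"
    if "A \<in> Z" "A' \<in> Z" "B \<in> Ob C" "B' \<in> Ob C" "a \<in> Hom ?D A' A" and b: "b \<in> Hom C B B'"
      and f: "f \<in> Hom C A B" for A A' B B' a b f
  proof -
    have a: "a \<in> Hom C A' A" using that by (auto dest: Hom_full_subcatD)
    note l = lift_hom[OF that(1) f]
    have bl: "ga b \<cdot> lift A B f \<in> Hom C A (g B')" using comp_hom[OF l ga_hom[OF b]] .
    have bf: "b \<cdot> f \<in> Hom C A B'" using comp_hom[OF f b] .
    have "\<epsilon> B' \<cdot> (ga b \<cdot> lift A B f \<cdot> a) = \<epsilon> B' \<cdot> (ga b \<cdot> lift A B f) \<cdot> a"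
      using comp_assoc[OF a bl \<epsilon>h[OF that(4)]] by simp
    also have "\<epsilon> B' \<cdot> (ga b \<cdot> lift A B f) = \<epsilon> B' \<cdot> ga b \<cdot> lift A B f"
      using comp_assoc[OF l ga_hom[OF b] \<epsilon>h[OF that(4)]] by simp
    also have "\<dots> = b \<cdot> (\<epsilon> B \<cdot> lift A B f)"
      using comp_assoc[OF l \<epsilon>h[OF that(3)] b] ga_comp[OF b] by simp
    also have "\<dots> = b \<cdot> f" using lift_comp[OF that(1) f] by simp
    finally show ?thesis
      using uniq[OF that(2,4) lift_hom[OF that(2) comp_hom[OF a bf]] comp_hom[OF a bl]]
        lift_comp[OF that(2) comp_hom[OF a bf]] by simp
  qed
  ultimately have "adjoint_functors ?D C inclusion G"
    unfolding adjoint_functors_def using F1 F2 by (intro conjI exI[of _ lift]) auto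
  then show ?thesis by (auto simp: coreflective_def)
qed

end

section \<open>Preadditive categories\<close>

context preadditive_category
begin

section \<open>Zero maps and differences\<close>

lemma zero_hom: "A \<in> Ob C \<Longrightarrow> B \<in> Ob C \<Longrightarrow> Zero C A B \<in> Hom C A B"
  using comm_group.axioms(2)[OF hom_comm_group[of A B]] group.is_monoid monoid.one_closed
  by (fastforce simp: hom_group_def)

lemma add_hom:
  assumes "f \<in> Hom C A B" "g \<in> Hom C A B" shows "f \<boxplus> g \<in> Hom C A B"
proof -
  interpret comm_group "hom_group C A B" using hom_comm_group Hom_Ob[OF assms(1)] by blast
  show ?thesis using m_closed[of f g] assms by (simp add: hom_group_def)
qed

lemma add_zero_right: assumes "f \<in> Hom C A B" shows "f \<boxplus> Zero C A B = f"
proof -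
  interpret comm_group "hom_group C A B" using hom_comm_group Hom_Ob[OF assms(1)] by blast
  show ?thesis using r_one[of f] assms by (simp add: hom_group_def)
qed

lemma add_zero_left: assumes "f \<in> Hom C A B" shows "Zero C A B \<boxplus> f = f"
proof -
  interpret comm_group "hom_group C A B" using hom_comm_group Hom_Ob[OF assms(1)] by blast
  show ?thesis using l_one[of f] assms by (simp add: hom_group_def)
qed

lemma add_eq_self_imp_zero:
  assumes "f \<in> Hom C A B" "d \<in> Hom C A B" "f \<boxplus> d = f" shows "d = Zero C A B"
proof -
  interpret comm_group "hom_group C A B" using hom_comm_group Hom_Ob[OF assms(1)] by blast
  show ?thesis using l_cancel_one[of f d] assms by (simp add: hom_group_def)
qed

text \<open>Differences are handled existentially, as a \<open>d\<close> with
  \<open>f = g \<boxplus> d\<close>, so that no inverse has to be carried through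
  compositions.\<close>

lemma ex_diff:
  assumes "f \<in> Hom C A B" "g \<in> Hom C A B"
  obtains d where "d \<in> Hom C A B" "f = g \<boxplus> d"
proof -
  interpret comm_group "hom_group C A B" using hom_comm_group Hom_Ob[OF assms(1)] by blast
  let ?i = "inv\<^bsub>hom_group C A B\<^esub> g"
  have c: "f \<in> carrier (hom_group C A B)" "g \<in> carrier (hom_group C A B)"
    using assms by (auto simp: hom_group_def)
  have "?i \<otimes>\<^bsub>hom_group C A B\<^esub> f \<in> carrier (hom_group C A B)"
    "f = g \<otimes>\<^bsub>hom_group C A B\<^esub> (?i \<otimes>\<^bsub>hom_group C A B\<^esub> f)"
    using c by (auto simp: m_assoc[symmetric])
  then show thesis using that by (auto simp: hom_group_def)
qed

lemma comp_zero_right: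
  assumes g: "g \<in> Hom C B D" and A: "A \<in> Ob C" shows "g \<cdot> Zero C A B = Zero C A D"
proof -
  have z: "Zero C A B \<in> Hom C A B" using zero_hom A Hom_Ob[OF g] by blast
  show ?thesis
    using comp_add_right[OF z z g] add_zero_right[OF z] comp_hom[OF z g]
      add_eq_self_imp_zero by metis
qed

lemma comp_zero_left:
  assumes f: "f \<in> Hom C A B" and D: "D \<in> Ob C" shows "Zero C B D \<cdot> f = Zero C A D"
proof -
  have z: "Zero C B D \<in> Hom C B D" using zero_hom D Hom_Ob[OF f] by blast
  show ?thesis
    using comp_add_left[OF f z z] add_zero_right[OF z] comp_hom[OF f z]
      add_eq_self_imp_zero by metis
qed

lemma ex_diff_right:
  assumes f: "f \<in> Hom C A B" and g: "g \<in> Hom C B D" "g' \<in> Hom C B D" "g \<cdot> f = g' \<cdot> f"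
  obtains d where "d \<in> Hom C B D" "g = g' \<boxplus> d" "d \<cdot> f = Zero C A D"
proof -
  obtain d where d: "d \<in> Hom C B D" "g = g' \<boxplus> d" using ex_diff g by metis
  have "g' \<cdot> f \<boxplus> d \<cdot> f = g' \<cdot> f" using comp_add_left[OF f g(2) d(1)] d(2) g(3) by simp
  then show thesis
    using that d add_eq_self_imp_zero[OF comp_hom[OF f g(2)] comp_hom[OF f d(1)]] by blast
qed

lemma ex_diff_left:
  assumes g: "g \<in> Hom C B D" and f: "f \<in> Hom C A B" "f' \<in> Hom C A B" "g \<cdot> f = g \<cdot> f'"
  obtains d where "d \<in> Hom C A B" "f = f' \<boxplus> d" "g \<cdot> d = Zero C A D"
proof -
  obtain d where d: "d \<in> Hom C A B" "f = f' \<boxplus> d" using ex_diff f by metis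
  have "g \<cdot> f' \<boxplus> g \<cdot> d = g \<cdot> f'" using comp_add_right[OF f(2) d(1) g] d(2) f(3) by simp
  then show thesis
    using that d add_eq_self_imp_zero[OF comp_hom[OF f(2) g] comp_hom[OF d(1) g]] by blast
qed

text \<open>Composition with \<open>e\<close> is additive on hom groups, so injectivity may be
  tested at zero.\<close>

lemma is_coreflectionI:
  assumes e: "is_precover C Z A e" and Z: "Z \<subseteq> Ob C"
    and ker: "\<And>X d. \<lbrakk>X \<in> Z; d \<in> Hom C X (Dom C e); e \<cdot> d = Zero C X A\<rbrakk> \<Longrightarrow> d = Zero C X (Dom C e)"
  shows "is_coreflection C Z A e"
proof -
  have eh: "e \<in> Hom C (Dom C e) A" using e by (auto simp: is_precover_def Hom_def)
  have "inj_on (\<lambda>h. e \<cdot> h) (Hom C X (Dom C e))" if X: "X \<in> Z" for X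
  proof (rule inj_onI)
    fix m n assume m: "m \<in> Hom C X (Dom C e)" and n: "n \<in> Hom C X (Dom C e)" and eq: "e \<cdot> m = e \<cdot> n"
    obtain d where "d \<in> Hom C X (Dom C e)" "m = n \<boxplus> d" "e \<cdot> d = Zero C X A"
      using ex_diff_left[OF eh m n eq] .
    then show "m = n" using ker[OF X] add_zero_right[OF n] by simp
  qed
  then show ?thesis using e unfolding is_coreflection_def is_precover_def bij_betw_def by blast
qed

text \<open>\<open>closed_under_summands\<close> speaks of biproducts, so a retract must be given a
  complement; splitting the complementary idempotent 1 - i p provides it.\<close>

lemma retract_mem:
  assumes Z: "Z \<subseteq> Ob C" "closed_under_summands C Z" and split: "split_idempotents C"
    and X: "X \<in> Z" and i: "i \<in> Hom C B X" and p: "p \<in> Hom C X B" and pi: "p \<cdot> i = Ident C B"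
  shows "B \<in> Z"
proof -
  have O: "B \<in> Ob C" "X \<in> Ob C" using Hom_Ob[OF i] by auto
  let ?e = "i \<cdot> p"
  have e: "?e \<in> Hom C X X" using comp_hom[OF p i] .
  have ei: "?e \<cdot> i = i" using comp_assoc[OF i p i] pi id_right[OF i] by simp
  have pe: "p \<cdot> ?e = p" using comp_assoc[OF p i p] pi id_left[OF p] by simp
  \<comment> \<open>\<open>d\<close> is 1 - i p; the next steps show that it is idempotent and
    orthogonal to \<open>i\<close> and \<open>p\<close>.\<close>
  obtain d where d: "d \<in> Hom C X X" and one: "Ident C X = ?e \<boxplus> d"
    using ex_diff[OF id_hom[OF O(2)] e] .
  have "i = i \<boxplus> d \<cdot> i" using comp_add_left[OF i e d] one ei id_left[OF i] by simp
  then have di: "d \<cdot> i = Zero C B X"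
    using add_eq_self_imp_zero[OF i comp_hom[OF i d]] by simp
  have "p = p \<boxplus> p \<cdot> d" using comp_add_right[OF e d p] one pe id_right[OF p] by simp
  then have pd: "p \<cdot> d = Zero C X B"
    using add_eq_self_imp_zero[OF p comp_hom[OF d p]] by simp
  have ed: "?e \<cdot> d = Zero C X X" using comp_assoc[OF d p i] pd comp_zero_right[OF i O(2)] by simp
  have dd: "d \<cdot> d = d"
    using comp_add_left[OF d e d] one ed id_left[OF d] add_zero_left[OF comp_hom[OF d d]] by simp
  obtain E j q where E: "E \<in> Ob C" and j: "j \<in> Hom C E X" and q: "q \<in> Hom C X E"
    and dj: "d = j \<cdot> q" and qj: "q \<cdot> j = Ident C E"
    using split d dd O(2) unfolding split_idempotents_def by metis
  have "q \<cdot> d = q" using comp_assoc[OF q j q] dj qj id_left[OF q] by simp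
  then have qi: "q \<cdot> i = Zero C B E"
    using comp_assoc[OF i d q] di comp_zero_right[OF q O(1)] by simp
  have "d \<cdot> j = j" using comp_assoc[OF j q j] dj qj id_right[OF j] by simp
  then have pj: "p \<cdot> j = Zero C E B"
    using comp_assoc[OF j d p] pd comp_zero_left[OF j O(1)] by simp
  have "is_biproduct C B E X i j p q"
    unfolding is_biproduct_def using O E i j p q pi qj qi pj one dj by simp
  then show ?thesis using Z X unfolding closed_under_summands_def by blast
qed

lemma hom_to_zero_object: "zero_object C N \<Longrightarrow> f \<in> Hom C A N \<Longrightarrow> f = Zero C A N"
  using Hom_Ob zero_hom unfolding zero_object_def by blast

lemma zero_objectI:
  assumes N: "N \<in> Ob C" and eq: "Ident C N = Zero C N N" shows "zero_object C N"
  unfolding zero_object_def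
proof (intro conjI ballI)
  fix A assume A: "A \<in> Ob C"
  have "f = Zero C N A" if "f \<in> Hom C N A" for f
    using id_right[OF that] comp_zero_right[OF that N] eq by simp
  then show "\<exists>!f. f \<in> Hom C N A" using zero_hom[OF N A] by blast
  have "f = Zero C A N" if "f \<in> Hom C A N" for f
    using id_left[OF that] comp_zero_left[OF that N] eq by simp
  then show "\<exists>!f. f \<in> Hom C A N" using zero_hom[OF A N] by blast
qed (rule N)

text \<open>A zero object is a retract of every object; \<open>X\<close> ensures that
  \<open>Z\<close> has one.\<close>

lemma zero_object_mem:
  assumes Z: "Z \<subseteq> Ob C" "closed_under_summands C Z" and split: "split_idempotents C"
    and N: "zero_object C N" and X: "X \<in> Z"
  shows "N \<in> Z"
proof -
  have O: "N \<in> Ob C" "X \<in> Ob C" using N Z X by (auto simp: zero_object_def)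
  have "Zero C X N \<cdot> Zero C N X = Ident C N"
    using hom_to_zero_object[OF N] comp_hom[OF zero_hom[OF O] zero_hom[OF O(2,1)]] id_hom[OF O(1)]
    by metis
  then show ?thesis using retract_mem[OF Z split X zero_hom[OF O] zero_hom[OF O(2,1)]] by simp
qed

end

section \<open>Right triangulated categories\<close>

context right_triangulated_category
begin

section \<open>Exactness of right triangles\<close>

lemma triangle_homs:
  assumes "(f, g, h) \<in> T"
  shows "f \<in> Hom C (Dom C f) (Cod C f)" "g \<in> Hom C (Cod C f) (Cod C g)"
    "h \<in> Hom C (Cod C g) (obmap S (Dom C f))"
  using triangle_sequence[OF assms] by (auto simp: right_sequence_def Hom_def)

lemma suspension_functor: "is_functor C C S"
  using suspension_additive by (simp add: additive_functor_def)

text \<open>By additivity the identity of \<open>obmap S N\<close>, as the image of a zero map, is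
  its own double and hence zero.\<close>

lemma suspension_zero_object:
  assumes N: "zero_object C N" shows "zero_object C (obmap S N)"
proof -
  have O: "N \<in> Ob C" using N by (simp add: zero_object_def)
  let ?z = "Zero C N N"
  have z: "?z \<in> Hom C N N" using zero_hom O by blast
  have I: "Ident C N = ?z" using hom_to_zero_object[OF N] id_hom[OF O] by blast
  have SO: "obmap S N \<in> Ob C" using suspension_functor O by (auto simp: is_functor_def)
  have SI: "armap S ?z = Ident C (obmap S N)"
    using suspension_functor O I by (auto simp: is_functor_def)
  have "armap S ?z \<boxplus> armap S ?z = armap S ?z"
    using suspension_additive z add_zero_right[OF z] unfolding additive_functor_def by metis
  then show ?thesis
    using zero_objectI[OF SO] add_eq_self_imp_zero[OF id_hom[OF SO] id_hom[OF SO]] SI by simp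
qed

text \<open>RT3 maps the rotated trivial triangle X -> X -> \<Sigma>0 -> \<Sigma>X to the given one
  by the identity and \<open>f\<close>, which makes \<open>g \<cdot> f\<close> factor through
  \<Sigma>0 by a zero map.\<close>

lemma triangle_comp_zero:
  assumes t: "(f, g, h) \<in> T" shows "g \<cdot> f = Zero C (Dom C f) (Cod C g)"
proof -
  note H = triangle_homs[OF t]
  obtain N where N: "zero_object C N" using ex_zero_object by blast
  let ?X = "Dom C f"
  have O: "N \<in> Ob C" "?X \<in> Ob C" "obmap S N \<in> Ob C" "Cod C g \<in> Ob C"
    using N Hom_Ob H suspension_zero_object[OF N] by (auto simp: zero_object_def)
  have i: "Ident C ?X \<in> Hom C ?X ?X" using id_hom O by blast
  have z: "Zero C ?X (obmap S N) \<in> Hom C ?X (obmap S N)" using zero_hom O by blast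
  have d: "Dom C (Ident C ?X) = ?X" "Cod C (Ident C ?X) = ?X" using i by (auto simp: Hom_def)
  have cz: "Cod C (Zero C ?X (obmap S N)) = obmap S N" using z by (auto simp: Hom_def)
  obtain c where c: "c \<in> Hom C (obmap S N) (Cod C g)" "c \<cdot> Zero C ?X (obmap S N) = g \<cdot> f"
    using RT3[OF RT2[OF RT1_zero[OF N O(2)]] t, of "Ident C ?X" f] i H(1) d cz by auto
  then show ?thesis using comp_zero_right[OF c(1) O(2)] by simp
qed

text \<open>\<open>g\<close> is a pseudocokernel of \<open>f\<close>: RT3 maps the triangle to 0 ->
  W -> W -> \<Sigma>0 by zero and \<open>u\<close>, and the third component is the
  factorization.\<close>

lemma triangle_factor:
  assumes t: "(f, g, h) \<in> T" and u: "u \<in> Hom C (Cod C f) W" "u \<cdot> f = Zero C (Dom C f) W"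
  obtains c where "c \<in> Hom C (Cod C g) W" "c \<cdot> g = u"
proof -
  note H = triangle_homs[OF t]
  obtain N where N: "zero_object C N" using ex_zero_object by blast
  let ?X = "Dom C f"
  have O: "N \<in> Ob C" "?X \<in> Ob C" "W \<in> Ob C"
    using N Hom_Ob[OF H(1)] Hom_Ob[OF u(1)] by (auto simp: zero_object_def)
  have zXN: "Zero C ?X N \<in> Hom C ?X N" and zNW: "Zero C N W \<in> Hom C N W"
    using zero_hom O by blast+
  have d: "Dom C (Zero C N W) = N" "Cod C (Zero C N W) = W" "Cod C (Ident C W) = W"
    using zNW id_hom[OF O(3)] by (auto simp: Hom_def)
  have "u \<cdot> f = Zero C N W \<cdot> Zero C ?X N" using u(2) comp_zero_right[OF zNW O(2)] by simp
  then obtain c where "c \<in> Hom C (Cod C g) W" "c \<cdot> g = Ident C W \<cdot> u"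
    using RT3[OF t RT1_zero[OF N O(3)], of "Zero C ?X N" u] zXN u(1) d by auto
  then show thesis using that id_left[OF u(1)] by simp
qed

text \<open>If \<open>e\<close> is the coreflection of the cone, the cone map \<open>g\<close> is \<open>e r g\<close> for some \<open>r\<close>, so
  \<open>1 - e r\<close> factors through \<open>\<Sigma> X \<in> Z\<close> and hence through \<open>e\<close>, which is therefore split epi.\<close>

lemma coreflective_closed_under_cones:
  assumes Z: "iso_closed_subcategory C Z" and c: "coreflective C Z" and SZ: "obmap S ` Z \<subseteq> Z"
  shows "closed_under_cones C T Z"
proof -
  have ZO: "Z \<subseteq> Ob C" using Z by (simp add: iso_closed_subcategory_def)
  have "Cod C g \<in> Z" if t: "(f, g, h) \<in> T" and X: "Dom C f \<in> Z" and Y: "Cod C f \<in> Z" for f g h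
  proof -
    note H = triangle_homs[OF t]
    let ?X = "Dom C f" and ?Y = "Cod C f" and ?D = "Cod C g"
    have D: "?D \<in> Ob C" and XO: "?X \<in> Ob C" using Hom_Ob H by blast+
    have SX: "obmap S ?X \<in> Z" using SZ X by auto
    obtain e where e: "is_coreflection C Z ?D e" using coreflective_ex_coreflection[OF ZO c D] by blast
    let ?B = "Dom C e"
    have eh: "e \<in> Hom C ?B ?D" and B: "?B \<in> Z"
      and bij: "\<And>W. W \<in> Z \<Longrightarrow> bij_betw (\<lambda>h. e \<cdot> h) (Hom C W ?B) (Hom C W ?D)"
      using e by (auto simp: is_coreflection_def Hom_def)
    have lift: "\<exists>m \<in> Hom C W ?B. e \<cdot> m = k" if "W \<in> Z" "k \<in> Hom C W ?D" for W k
      using is_precover_lift[OF is_coreflection_precover[OF e] that] .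
    obtain g' where g': "g' \<in> Hom C ?Y ?B" "e \<cdot> g' = g" using lift[OF Y H(2)] by blast
    have BO: "?B \<in> Ob C" using B ZO by auto
    \<comment> \<open>As X lies in \<open>Z\<close>, \<open>e\<close> can be cancelled: the lift
      \<open>g'\<close> of \<open>g\<close> also kills \<open>f\<close> and so factors through the
      cone.\<close>
    have "e \<cdot> (g' \<cdot> f) = e \<cdot> Zero C ?X ?B"
      using comp_assoc[OF H(1) g'(1) eh] g'(2) triangle_comp_zero[OF t] comp_zero_right[OF eh XO] by simp
    then have "g' \<cdot> f = Zero C ?X ?B"
      using bij[OF X] comp_hom[OF H(1) g'(1)] zero_hom[OF XO BO]
      by (auto simp: bij_betw_def dest: inj_onD)
    then obtain r where r: "r \<in> Hom C ?D ?B" "r \<cdot> g = g'" using triangle_factor[OF t g'(1)] by blast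
    have er: "e \<cdot> r \<in> Hom C ?D ?D" using comp_hom[OF r(1) eh] .
    have "Ident C ?D \<cdot> g = e \<cdot> r \<cdot> g"
      using comp_assoc[OF H(2) r(1) eh] r(2) g'(2) id_left[OF H(2)] by simp
    then obtain d where d: "d \<in> Hom C ?D ?D" "Ident C ?D = e \<cdot> r \<boxplus> d" "d \<cdot> g = Zero C ?Y ?D"
      using ex_diff_right[OF H(2) id_hom[OF D] er] by blast
    have gd: "Dom C g = ?Y" "Cod C h = obmap S ?X" using H by (auto simp: Hom_def)
    \<comment> \<open>In the rotated triangle \<open>h\<close> is a pseudocokernel of
      \<open>g\<close>, so \<open>d\<close> = 1 - e r factors through \<Sigma>X. Closure of
      \<open>Z\<close> under \<Sigma> then allows the factor \<open>s\<close> to be lifted along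
      \<open>e\<close>.\<close>
    obtain s where s: "s \<in> Hom C (obmap S ?X) ?D" "s \<cdot> h = d"
      using triangle_factor[OF RT2[OF t], of d ?D] d gd by auto
    obtain s' where s': "s' \<in> Hom C (obmap S ?X) ?B" "e \<cdot> s' = s" using lift[OF SX s(1)] by blast
    have s'h: "s' \<cdot> h \<in> Hom C ?D ?B" using comp_hom[OF H(3) s'(1)] .
    have "e \<cdot> (r \<boxplus> s' \<cdot> h) = Ident C ?D"
      using comp_add_right[OF r(1) s'h eh] comp_assoc[OF H(3) s'(1) eh] s'(2) s(2) d(2) by simp
    then show ?thesis using coreflection_section_imp_mem[OF Z e add_hom[OF r(1) s'h]] by blast
  qed
  then show ?thesis by (auto simp: closed_under_cones_def)
qed

text \<open>Rotating 0 -> X -> X -> \<Sigma>0 twice gives X -> \<Sigma>0 -> \<Sigma>X -> \<Sigma>X,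
  which exhibits \<Sigma>X as the cone of a map between objects of \<open>Z\<close>.\<close>

lemma cones_imp_suspension_closed:
  assumes Z: "Z \<subseteq> Ob C" "closed_under_summands C Z" and split: "split_idempotents C"
    and cones: "closed_under_cones C T Z"
  shows "obmap S ` Z \<subseteq> Z"
proof
  fix Y assume "Y \<in> obmap S ` Z"
  then obtain X where X: "X \<in> Z" and Y: "Y = obmap S X" by blast
  obtain N where N: "zero_object C N" using ex_zero_object by blast
  note SN = suspension_zero_object[OF N]
  have O: "X \<in> Ob C" "obmap S N \<in> Ob C" using X Z SN by (auto simp: zero_object_def)
  have SNZ: "obmap S N \<in> Z" using zero_object_mem[OF Z split SN X] .
  note t = RT2[OF RT2[OF RT1_zero[OF N O(1)]]]
  have z: "Dom C (Zero C X (obmap S N)) = X" "Cod C (Zero C X (obmap S N)) = obmap S N"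
    using zero_hom[OF O] by (auto simp: Hom_def)
  have I: "Dom C (Ident C X) = X" using id_hom[OF O(1)] by (simp add: Hom_def)
  have NO: "N \<in> Ob C" using N by (simp add: zero_object_def)
  have "Cod C (neg C (armap S (Zero C N X))) = Y"
    using triangle_homs(3)[OF RT2[OF RT1_zero[OF N O(1)]]] I Y by (auto simp: Hom_def)
  then show "Y \<in> Z" using cones t X SNZ z unfolding closed_under_cones_def by fastforce
qed

text \<open>Let \<open>f\<close> be a precover of \<open>A\<close>, \<open>k\<close> a pseudokernel of \<open>f\<close> and \<open>x\<close> a precover of the domain
  of \<open>k\<close>. In the triangle on \<open>k x\<close> with second map \<open>g\<close>, \<open>f = f' g\<close> and \<open>f' = f r\<close>;
  every map from \<open>Z\<close> killed by \<open>f\<close> is killed by \<open>g\<close>, so \<open>g r\<close> is idempotent and \<open>f'\<close> restricted to its image is a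
  coreflection.\<close>

lemma precovering_imp_coreflective:
  assumes Z: "Z \<subseteq> Ob C" "closed_under_summands C Z" and split: "split_idempotents C"
    and pk: "has_pseudokernels C" and pre: "precovering C Z" and cones: "closed_under_cones C T Z"
  shows "coreflective C Z"
proof (rule coreflective_if_ex_coreflection[OF Z(1)])
  fix A assume A: "A \<in> Ob C"
  obtain f where f: "is_precover C Z A f" using pre A by (auto simp: precovering_def)
  let ?Y = "Dom C f"
  have fh: "f \<in> Hom C ?Y A" and Y: "?Y \<in> Z"
    using f by (auto simp: is_precover_def Hom_def)
  note flift = is_precover_lift[OF f]
  have YO: "?Y \<in> Ob C" using Y Z by auto
  obtain k where k: "is_pseudokernel C f k"
    using pk fh unfolding has_pseudokernels_def Hom_def by blast
  let ?K = "Dom C k"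
  have codf: "Cod C f = A" using fh by (simp add: Hom_def)
  have kh: "k \<in> Hom C ?K ?Y" and fk: "f \<cdot> k = Zero C ?K A"
    using k codf by (auto simp: is_pseudokernel_def Hom_def)
  have klift: "\<exists>u \<in> Hom C W ?K. k \<cdot> u = m"
    if "W \<in> Ob C" "m \<in> Hom C W ?Y" "f \<cdot> m = Zero C W A" for W m
    using k that codf unfolding is_pseudokernel_def by blast
  obtain x where x: "is_precover C Z ?K x" using pre Hom_Ob[OF kh] by (auto simp: precovering_def)
  let ?X = "Dom C x"
  have xh: "x \<in> Hom C ?X ?K" and X: "?X \<in> Z"
    using x by (auto simp: is_precover_def Hom_def)
  note xlift = is_precover_lift[OF x]
  have XO: "?X \<in> Ob C" using X Z by auto
  let ?w = "k \<cdot> x"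
  have wh: "?w \<in> Hom C ?X ?Y" using comp_hom[OF xh kh] .
  have wd: "Dom C ?w = ?X" "Cod C ?w = ?Y" using wh by (auto simp: Hom_def)
  have fw: "f \<cdot> ?w = Zero C ?X A" using comp_assoc[OF xh kh fh] fk comp_zero_left[OF xh A] by simp
  obtain g h where t: "(?w, g, h) \<in> T" using RT1_embed[of ?w] wh by (auto simp: Hom_def)
  let ?D = "Cod C g"
  have gh: "g \<in> Hom C ?Y ?D" using triangle_homs(2)[OF t] wd by simp
  have D: "?D \<in> Z" using cones t X Y wd unfolding closed_under_cones_def by fastforce
  have DO: "?D \<in> Ob C" using D Z by auto
  have gw: "g \<cdot> ?w = Zero C ?X ?D" using triangle_comp_zero[OF t] wd by simp
  \<comment> \<open>Such an \<open>m\<close> lifts along \<open>k\<close>, and then along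
    \<open>x\<close> because \<open>W\<close> is in \<open>Z\<close>; so it factors through
    \<open>?w\<close>, which \<open>g\<close> kills.\<close>
  have gm: "g \<cdot> m = Zero C W ?D" if W: "W \<in> Z" and m: "m \<in> Hom C W ?Y" "f \<cdot> m = Zero C W A" for W m
  proof -
    have WO: "W \<in> Ob C" using W Z by auto
    obtain u where u: "u \<in> Hom C W ?K" "k \<cdot> u = m" using klift[OF WO m] by blast
    obtain v where v: "v \<in> Hom C W ?X" "x \<cdot> v = u" using xlift[OF W u(1)] by blast
    have "?w \<cdot> v = m" using comp_assoc[OF v(1) xh kh] u v by simp
    then show ?thesis using comp_assoc[OF v(1) wh gh] gw comp_zero_left[OF v(1) DO] by simp
  qed
  obtain f' where f': "f' \<in> Hom C ?D A" "f' \<cdot> g = f"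
    using triangle_factor[OF t, of f A] fh fw wd by auto
  obtain r where r: "r \<in> Hom C ?D ?Y" "f \<cdot> r = f'" using flift[OF D f'(1)] by blast
  have rg: "r \<cdot> g \<in> Hom C ?Y ?Y" using comp_hom[OF gh r(1)] .
  have "f \<cdot> Ident C ?Y = f \<cdot> (r \<cdot> g)"
    using comp_assoc[OF gh r(1) fh] r(2) f'(2) id_right[OF fh] by simp
  then obtain d where d: "d \<in> Hom C ?Y ?Y" "Ident C ?Y = r \<cdot> g \<boxplus> d" "f \<cdot> d = Zero C ?Y A"
    using ex_diff_left[OF fh id_hom[OF YO] rg] by blast
  \<comment> \<open>\<open>d\<close> = 1 - r g is itself a map from an object of \<open>Z\<close>
    killed by \<open>f\<close>, so \<open>gm\<close> applies to it.\<close>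
  have "g \<cdot> (r \<cdot> g) = g"
    using comp_add_right[OF rg d(1) gh] gm[OF Y d(1,3)] d(2) id_right[OF gh]
      add_zero_right[OF comp_hom[OF rg gh]] by simp
  then have grg: "g \<cdot> r \<cdot> g = g" using comp_assoc[OF gh r(1) gh] by simp
  let ?e = "g \<cdot> r"
  have eh: "?e \<in> Hom C ?D ?D" using comp_hom[OF r(1) gh] .
  have "?e \<cdot> ?e = ?e" using comp_assoc[OF r(1) gh eh] grg by simp
  then obtain B i p where B: "B \<in> Ob C" and i: "i \<in> Hom C B ?D" and p: "p \<in> Hom C ?D B"
    and e: "?e = i \<cdot> p" and pi: "p \<cdot> i = Ident C B"
    using split eh DO unfolding split_idempotents_def by metis
  have BZ: "B \<in> Z" using retract_mem[OF Z split D i p pi] .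
  let ?c = "f' \<cdot> i"
  have ch: "?c \<in> Hom C B A" using comp_hom[OF i f'(1)] .
  have cd: "Dom C ?c = B" "Cod C ?c = A" "?c \<in> Ar C" using ch by (auto simp: Hom_def)
  have "?c \<cdot> p = f' \<cdot> ?e" using comp_assoc[OF p i f'(1)] e by simp
  also have "\<dots> = f'" using comp_assoc[OF r(1) gh f'(1)] f'(2) r(2) by simp
  finally have cp: "?c \<cdot> p = f'" .
  have pgh: "p \<cdot> g \<in> Hom C ?Y B" using comp_hom[OF gh p] .
  \<comment> \<open>The precover \<open>f\<close> factors through \<open>?c\<close>, so
    \<open>?c\<close> inherits the lifting property.\<close>
  have cpg: "?c \<cdot> (p \<cdot> g) = f" using comp_assoc[OF gh p ch] cp f'(2) by simp
  have clift: "m \<in> (\<lambda>h. ?c \<cdot> h) ` Hom C W B" if W: "W \<in> Z" and m: "m \<in> Hom C W A" for W m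
  proof -
    obtain n where n: "n \<in> Hom C W ?Y" "f \<cdot> n = m" using flift[OF W m] by blast
    have "?c \<cdot> (p \<cdot> g \<cdot> n) = m" using comp_assoc[OF n(1) pgh ch] cpg n(2) by simp
    then show ?thesis using comp_hom[OF n(1) pgh] by blast
  qed
  have "(\<lambda>h. ?c \<cdot> h) ` Hom C W B = Hom C W A" if W: "W \<in> Z" for W
    using clift[OF W] comp_hom[OF _ ch] by blast
  then have cpre: "is_precover C Z A ?c"
    using BZ cd by (simp add: is_precover_def)
  have ei: "?e \<cdot> i = i" using comp_assoc[OF i p i] e pi id_right[OF i] by simp
  have "is_coreflection C Z A ?c"
  proof (rule is_coreflectionI[OF cpre Z(1)], unfold cd)
    fix W m assume W: "W \<in> Z" and m: "m \<in> Hom C W B" and z: "?c \<cdot> m = Zero C W A"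
    have WO: "W \<in> Ob C" using W Z by auto
    have im: "i \<cdot> m \<in> Hom C W ?D" using comp_hom[OF m i] .
    \<comment> \<open>Moving \<open>m\<close> back to Y by \<open>r \<cdot> i\<close> makes
      \<open>gm\<close> applicable; \<open>i\<close> is fixed by \<open>?e\<close> and split by
      \<open>p\<close>, so \<open>m\<close> is recovered.\<close>
    have "f \<cdot> (r \<cdot> (i \<cdot> m)) = Zero C W A"
      using comp_assoc[OF im r(1) fh] r(2) comp_assoc[OF m i f'(1)] z by simp
    then have "g \<cdot> (r \<cdot> (i \<cdot> m)) = Zero C W ?D" using gm[OF W comp_hom[OF im r(1)]] by simp
    then have "i \<cdot> m = Zero C W ?D"
      using comp_assoc[OF im r(1) gh] comp_assoc[OF m i eh] ei by simp
    then have "p \<cdot> (i \<cdot> m) = Zero C W B" using comp_zero_right[OF p WO] by simp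
    then show "m = Zero C W B" using comp_assoc[OF m i p] pi id_left[OF m] by simp
  qed
  then show "\<exists>e. is_coreflection C Z A e" by blast
qed

section \<open>The equivalence for right triangulated categories\<close>

theorem coreflective_suspension_closed_iff:
  assumes Z: "iso_closed_subcategory C Z" and split: "split_idempotents C"
    and pk: "has_pseudokernels C"
  shows "coreflective C Z \<and> obmap S ` Z \<subseteq> Z \<longleftrightarrow>
    precovering C Z \<and> closed_under_summands C Z \<and> closed_under_cones C T Z"
proof -
  have ZO: "Z \<subseteq> Ob C" using Z by (simp add: iso_closed_subcategory_def)
  have "precovering C Z" if "coreflective C Z"
    using coreflective_ex_coreflection[OF ZO that] is_coreflection_precover
    unfolding precovering_def by blast
  moreover have "closed_under_summands C Z" if c: "coreflective C Z"
    unfolding closed_under_summands_def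
  proof (intro allI impI)
    fix A B X i j p q assume a: "X \<in> Z \<and> is_biproduct C A B X i j p q"
    then have X: "X \<in> Z" and A: "A \<in> Ob C" and i: "i \<in> Hom C A X" and p: "p \<in> Hom C X A"
      and pi: "p \<cdot> i = Ident C A" by (auto simp: is_biproduct_def)
    obtain e where e: "is_coreflection C Z A e" using coreflective_ex_coreflection[OF ZO c A] by blast
    then have eh: "e \<in> Hom C (Dom C e) A" by (simp add: is_coreflection_def Hom_def)
    \<comment> \<open>Lifting the projection along \<open>e\<close> and restricting along the
      injection gives a section of \<open>e\<close>.\<close>
    obtain p' where p': "p' \<in> Hom C X (Dom C e)" "e \<cdot> p' = p"
      using is_precover_lift[OF is_coreflection_precover[OF e] X p] by blast
    have "e \<cdot> (p' \<cdot> i) = Ident C A" using comp_assoc[OF i p'(1) eh] p'(2) pi by simp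
    then show "A \<in> Z" using coreflection_section_imp_mem[OF Z e comp_hom[OF i p'(1)]] by blast
  qed
  ultimately show ?thesis
    using coreflective_closed_under_cones[OF Z] cones_imp_suspension_closed[OF ZO _ split]
      precovering_imp_coreflective[OF ZO _ split pk] by blast
qed

end

section \<open>Duality\<close>

lemma opposite_simps [simp]:
  "Ob (opposite C) = Ob C" "Ar (opposite C) = Ar C" "Dom (opposite C) = Cod C"
  "Cod (opposite C) = Dom C" "Ident (opposite C) = Ident C" "Comp (opposite C) g f = Comp C f g"
  "Add (opposite C) = Add C" "Zero (opposite C) A B = Zero C B A"
  by (simp_all add: opposite_def)

lemma Hom_opposite [simp]: "Hom (opposite C) A B = Hom C B A"
  by (auto simp: Hom_def)

lemma opposite_opposite [simp]: "opposite (opposite C) = C"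
  by (simp add: opposite_def)

lemma full_subcat_opposite: "full_subcat (opposite C) Z = opposite (full_subcat C Z)"
  by (cases C rule: preadd_cat.cases_scheme) (auto simp: full_subcat_def opposite_def)

lemma is_iso_opposite: "is_iso (opposite C) A B f \<longleftrightarrow> is_iso C B A f"
  unfolding is_iso_def by auto

text \<open>Reversal turns isomorphisms out of an object into isomorphisms into it; passing to the
  inverse restores the direction.\<close>

lemma iso_closed_subcategory_opposite:
  assumes "iso_closed_subcategory C Z" shows "iso_closed_subcategory (opposite C) Z"
proof -
  have "is_iso C A B g" if "is_iso C B A f" "g \<in> Hom C A B" "f \<cdot>\<^bsub>C\<^esub> g = Ident C A"
    "g \<cdot>\<^bsub>C\<^esub> f = Ident C B" for A B f g using that by (auto simp: is_iso_def)
  then show ?thesis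
    using assms unfolding iso_closed_subcategory_def is_iso_opposite
    by (simp, metis is_iso_def)
qed

lemma split_idempotents_opposite:
  "split_idempotents C \<Longrightarrow> split_idempotents (opposite C)"
  unfolding split_idempotents_def by (simp, metis)

lemma has_pseudokernels_opposite: "has_pseudokernels (opposite C) \<longleftrightarrow> has_pseudocokernels C"
  by (simp add: has_pseudokernels_def has_pseudocokernels_def is_pseudokernel_def
      is_pseudocokernel_def)

lemma precovering_opposite: "precovering (opposite C) Z \<longleftrightarrow> preenveloping C Z"
  by (simp add: precovering_def preenveloping_def is_precover_def is_preenvelope_def)
    (metis (no_types))

lemma is_biproduct_opposite:
  "is_biproduct (opposite C) A B X i j p q \<longleftrightarrow> is_biproduct C A B X p q i j"
  by (auto simp: is_biproduct_def)

lemma closed_under_summands_opposite: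
  "closed_under_summands (opposite C) Z \<longleftrightarrow> closed_under_summands C Z"
  unfolding closed_under_summands_def is_biproduct_opposite by blast

lemma closed_under_cones_opposite:
  "closed_under_cones (opposite C) {(g, f, h). (h, f, g) \<in> T} Z \<longleftrightarrow> closed_under_cocones C T Z"
  by (auto simp: closed_under_cones_def closed_under_cocones_def)

section \<open>Adjunctions in opposite categories\<close>

lemma is_functor_opposite:
  "is_functor C D F \<Longrightarrow> is_functor (opposite C) (opposite D) F"
  unfolding is_functor_def by simp

text \<open>The bijection for the reversed adjunction is the inverse of \<open>\<phi>\<close>. The
  category hypotheses supply associativity, since reversing composition also rebrackets the
  naturality condition.\<close>

lemma adjoint_functors_opposite:
  assumes "category C" "category D" and adj: "adjoint_functors C D F G"
  shows "adjoint_functors (opposite D) (opposite C) G F"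
proof -
  interpret C: category C by fact
  interpret D: category D by fact
  obtain \<phi> where F: "is_functor C D F" and G: "is_functor D C G"
    and bij: "\<And>A B. A \<in> Ob C \<Longrightarrow> B \<in> Ob D \<Longrightarrow>
        bij_betw (\<phi> A B) (Hom D (obmap F A) B) (Hom C A (obmap G B))"
    and nat: "\<And>A A' B B' a b f. \<lbrakk>A \<in> Ob C; A' \<in> Ob C; B \<in> Ob D; B' \<in> Ob D; a \<in> Hom C A' A;
        b \<in> Hom D B B'; f \<in> Hom D (obmap F A) B\<rbrakk>
        \<Longrightarrow> \<phi> A' B' (b \<cdot>\<^bsub>D\<^esub> f \<cdot>\<^bsub>D\<^esub> armap F a) = armap G b \<cdot>\<^bsub>C\<^esub> \<phi> A B f \<cdot>\<^bsub>C\<^esub> a"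
    using adjoint_functorsE[OF adj] by metis
  define \<psi> where "\<psi> B A = the_inv_into (Hom D (obmap F A) B) (\<phi> A B)" for A B
  have \<psi>: "bij_betw (\<psi> B A) (Hom C A (obmap G B)) (Hom D (obmap F A) B)"
    if "A \<in> Ob C" "B \<in> Ob D" for A B
    unfolding \<psi>_def by (rule bij_betw_the_inv_into[OF bij[OF that]])
  have \<psi>_hom: "\<psi> B A k \<in> Hom D (obmap F A) B" and \<phi>\<psi>: "\<phi> A B (\<psi> B A k) = k"
    if "A \<in> Ob C" "B \<in> Ob D" "k \<in> Hom C A (obmap G B)" for A B k
    using \<psi>[OF that(1,2)] f_the_inv_into_f_bij_betw[OF bij[OF that(1,2)]] that(3)
    unfolding \<psi>_def bij_betw_def by auto
  have "\<psi> B' A' (armap G a \<cdot>\<^bsub>C\<^esub> (f \<cdot>\<^bsub>C\<^esub> b)) = a \<cdot>\<^bsub>D\<^esub> (\<psi> B A f \<cdot>\<^bsub>D\<^esub> armap F b)"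
    if O: "B \<in> Ob D" "B' \<in> Ob D" "A \<in> Ob C" "A' \<in> Ob C" and a: "a \<in> Hom D B B'"
      and b: "b \<in> Hom C A' A" and f: "f \<in> Hom C A (obmap G B)" for A A' B B' a b f
  proof -
    have Fb: "armap F b \<in> Hom D (obmap F A') (obmap F A)"
      and Ga: "armap G a \<in> Hom C (obmap G B) (obmap G B')"
      using F G a b by (auto simp: is_functor_def)
    note p = \<psi>_hom[OF O(3,1) f]
    have h: "a \<cdot>\<^bsub>D\<^esub> \<psi> B A f \<cdot>\<^bsub>D\<^esub> armap F b \<in> Hom D (obmap F A') B'"
      using D.comp_hom[OF Fb D.comp_hom[OF p a]] .
    have "\<phi> A' B' (a \<cdot>\<^bsub>D\<^esub> \<psi> B A f \<cdot>\<^bsub>D\<^esub> armap F b) = armap G a \<cdot>\<^bsub>C\<^esub> (f \<cdot>\<^bsub>C\<^esub> b)"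
      using nat[OF O(3,4,1,2) b a p] \<phi>\<psi>[OF O(3,1) f] C.comp_assoc[OF b f Ga] by simp
    then have "\<psi> B' A' (armap G a \<cdot>\<^bsub>C\<^esub> (f \<cdot>\<^bsub>C\<^esub> b)) = a \<cdot>\<^bsub>D\<^esub> \<psi> B A f \<cdot>\<^bsub>D\<^esub> armap F b"
      unfolding \<psi>_def[of B' A']
      using the_inv_into_f_f[OF bij_betw_imp_inj_on[OF bij[OF O(4,2)]] h] by simp
    then show ?thesis using D.comp_assoc[OF Fb p a] by simp
  qed
  then show ?thesis
    unfolding adjoint_functors_def
    using is_functor_opposite[OF F] is_functor_opposite[OF G] \<psi>
    by (intro conjI exI[of _ \<psi>]) auto
qed

lemma category_full_subcat:
  assumes "category C" "Z \<subseteq> Ob C" shows "category (full_subcat C Z)"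
proof -
  interpret category C by fact
  show ?thesis
  proof
    show "Ident (full_subcat C Z) A \<in> Hom (full_subcat C Z) A A" if "A \<in> Ob (full_subcat C Z)" for A
      using that id_hom assms(2) by (auto simp: Hom_full_subcat)
  qed (auto simp: Hom_full_subcat comp_assoc id_left id_right
      dest!: Hom_full_subcatD intro: comp_hom)
qed

lemma category_opposite: "category C \<Longrightarrow> category (opposite C)"
  unfolding category_def by (simp add: Hom_def)

lemma coreflective_opposite:
  assumes C: "category C" and Z: "Z \<subseteq> Ob C"
  shows "coreflective (opposite C) Z \<longleftrightarrow> reflective C Z"
proof -
  note cats = C category_full_subcat[OF C Z]
  show ?thesis
    unfolding coreflective_def reflective_def full_subcat_opposite
    using adjoint_functors_opposite[OF cats]
      adjoint_functors_opposite[OF cats(2,1)[THEN category_opposite], unfolded opposite_opposite]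
    by blast
qed

theorem corollary4p4:
  fixes C :: "('o, 'm) preadd_cat" and Z :: "'o set"
  assumes "additive_category C"
    and "split_idempotents C"
    and "iso_closed_subcategory C Z"
  shows "(\<forall>S T. right_triangulated_category C S T \<and> has_pseudokernels C \<longrightarrow>
            (coreflective C Z \<and> obmap S ` Z \<subseteq> Z \<longleftrightarrow>
             precovering C Z \<and> closed_under_summands C Z \<and> closed_under_cones C T Z)) \<and>
         (\<forall>W T. left_triangulated_category C W T \<and> has_pseudocokernels C \<longrightarrow>
            (reflective C Z \<and> obmap W ` Z \<subseteq> Z \<longleftrightarrow>
             preenveloping C Z \<and> closed_under_summands C Z \<and> closed_under_cocones C T Z))"
proof (intro conjI allI impI)
  fix S T assume "right_triangulated_category C S T \<and> has_pseudokernels C"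
  then show "coreflective C Z \<and> obmap S ` Z \<subseteq> Z \<longleftrightarrow>
    precovering C Z \<and> closed_under_summands C Z \<and> closed_under_cones C T Z"
    using right_triangulated_category.coreflective_suspension_closed_iff assms by blast
next
  fix W T assume a: "left_triangulated_category C W T \<and> has_pseudocokernels C"
  interpret additive_category C by fact
  have Z: "Z \<subseteq> Ob C" using assms(3) by (simp add: iso_closed_subcategory_def)
  show "reflective C Z \<and> obmap W ` Z \<subseteq> Z \<longleftrightarrow>
    preenveloping C Z \<and> closed_under_summands C Z \<and> closed_under_cocones C T Z"
    \<comment> \<open>A left triangulation is by definition a right triangulation of the opposite
      category; each notion is then translated back.\<close>
    using right_triangulated_category.coreflective_suspension_closed_iff
      [OF a[THEN conjunct1, unfolded left_triangulated_category_def]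
        iso_closed_subcategory_opposite[OF assms(3)] split_idempotents_opposite[OF assms(2)]]
      a has_pseudokernels_opposite[of C] coreflective_opposite[OF category_axioms Z]
      precovering_opposite[of C Z] closed_under_summands_opposite[of C Z]
      closed_under_cones_opposite[of C T Z]
    by simp
qed

end
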